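(* There exists a dynamical system $(F_2,S^1,\Phi)$, where $F_2$ is the free group on two generators, which has a minimal set that is a Cantor set and such that $\Phi$ has the shadowing property.
   Context: $F_2$ is the free group on generators $a,b$, with finite symmetric generator $S=\{a,a^{-1},b,b^{-1}\}$. $S^1$ is the circle with its usual metric $d$. A dynamical system $(G,X,\Phi)$ consists of a (discrete) group $G$, a metric space $X$ and a continuous map $\Phi:G\times X\to X$ with $\Phi(g_1,\Phi(g_2,x))=\Phi(g_1g_2,x)$ for all $g_1,g_2\in G$, $x\in X$, such that each $\Phi_g=\Phi(g,\cdot):X\to X$ is a homeomorphism. The orbit of $x$ is $O(x)=\{\Phi_g(x):g\in G\}$. A non-empty set $M\subset X$ is minimal if $\overline{O(x)}=M$ for every $x\in M$. For $\delta>0$, a family $\{x_g\}_{g\in G}\subset X$ is a $\delta$-pseudotrajectory if $d(\Phi_s(x_g),x_{sg})<\delta$ for all $g\in G$ and all $s\in S$. The action $\Phi$ has the shadowing property if for every $\varepsilon>0$ there exists $\delta>0$ such that for every $\delta$-pseudotrajectory $\{x_g\}$ there exists $y\in X$ with $d(x_g,\Phi_g(y))<\varepsilon$ for all $g\in G$. *)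

theory Defs
  imports "HOL-Analysis.Analysis" "HOL-Algebra.Group"
begin

text \<open>
  The free group on \<open>X\<close> is modelled by the reduced words over the alphabet \<open>X \<times> bool\<close>, where
  \<open>(x, True)\<close> stands for \<open>x\<close> and \<open>(x, False)\<close> for its formal inverse.
\<close>

definition inv_letter :: "'x \<times> bool \<Rightarrow> 'x \<times> bool" where
  "inv_letter l = (fst l, \<not> snd l)"

definition reduced :: "('x \<times> bool) list \<Rightarrow> bool" where
  "reduced w \<longleftrightarrow> (\<forall>i. Suc i < length w \<longrightarrow> w ! Suc i \<noteq> inv_letter (w ! i))"

fun cons_reduce :: "'x \<times> bool \<Rightarrow> ('x \<times> bool) list \<Rightarrow> ('x \<times> bool) list" where
  "cons_reduce l [] = [l]"
| "cons_reduce l (m # w) = (if m = inv_letter l then w else l # m # w)"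

text \<open>For reduced \<open>u\<close> and \<open>v\<close>, \<open>foldr cons_reduce u v\<close> is the free reduction of \<open>u @ v\<close>.\<close>

definition free_group :: "'x set \<Rightarrow> ('x \<times> bool) list monoid" where
  "free_group X =
     \<lparr>carrier = {w. reduced w \<and> set w \<subseteq> X \<times> UNIV},
      mult = (\<lambda>u v. foldr cons_reduce u v),
      one = []\<rparr>"

lemma reduced_Nil [simp]: "reduced []"
  by (simp add: reduced_def)

lemma reduced_Cons:
  "reduced (l # w) \<longleftrightarrow> reduced w \<and> (w \<noteq> [] \<longrightarrow> hd w \<noteq> inv_letter l)"
  by (cases w) (auto simp: reduced_def nth_Cons split: nat.splits)

lemma inv_letter_inv_letter [simp]: "inv_letter (inv_letter l) = l"
  by (simp add: inv_letter_def)

lemma reduced_cons_reduce: "reduced w \<Longrightarrow> reduced (cons_reduce l w)"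
  by (cases w) (auto simp: reduced_Cons)

lemma reduced_foldr_cons_reduce: "reduced v \<Longrightarrow> reduced (foldr cons_reduce u v)"
  by (induction u) (auto intro: reduced_cons_reduce)

lemma set_cons_reduce: "set (cons_reduce l w) \<subseteq> insert l (set w)"
  by (cases w) auto

lemma set_foldr_cons_reduce: "set (foldr cons_reduce u v) \<subseteq> set u \<union> set v"
  by (induction u) (use set_cons_reduce in fastforce)+

lemma cons_reduce_cancel:
  "reduced w \<Longrightarrow> cons_reduce l (cons_reduce (inv_letter l) w) = w"
  by (cases w; cases "tl w") (auto simp: reduced_Cons)

lemma foldr_cons_reduce_cons_reduce:
  assumes "reduced w"
  shows "foldr cons_reduce (cons_reduce l v) w = cons_reduce l (foldr cons_reduce v w)"
proof (cases v)
  case (Cons m v')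
  then show ?thesis
    using cons_reduce_cancel[OF reduced_foldr_cons_reduce[OF assms, of v'], of l] by auto
qed simp

lemma foldr_cons_reduce_assoc:
  assumes "reduced w"
  shows "foldr cons_reduce (foldr cons_reduce u v) w = foldr cons_reduce u (foldr cons_reduce v w)"
  by (induction u) (use assms in \<open>auto simp: foldr_cons_reduce_cons_reduce\<close>)

lemma foldr_cons_reduce_Nil: "reduced u \<Longrightarrow> foldr cons_reduce u [] = u"
proof (induction u)
  case (Cons l u)
  then show ?case by (cases u) (auto simp: reduced_Cons)
qed simp

lemma foldr_cons_reduce_inverse:
  "reduced w \<Longrightarrow> foldr cons_reduce (rev (map inv_letter u)) (foldr cons_reduce u w) = w"
proof (induction u arbitrary: w)
  case (Cons l u)
  then show ?case
    using cons_reduce_cancel[OF reduced_foldr_cons_reduce[OF Cons.prems, of u], of "inv_letter l"]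
    by auto
qed simp

lemma group_free_group: "group (free_group X)"
proof (rule groupI)
  fix u assume u: "u \<in> carrier (free_group X)"
  let ?v = "foldr cons_reduce (rev (map inv_letter u)) []"
  have "?v \<in> carrier (free_group X)"
    using u set_foldr_cons_reduce[of "rev (map inv_letter u)" "[]"]
    by (fastforce simp: free_group_def inv_letter_def intro: reduced_foldr_cons_reduce)
  moreover have "?v \<otimes>\<^bsub>free_group X\<^esub> u = \<one>\<^bsub>free_group X\<^esub>"
    using u foldr_cons_reduce_inverse[of "[]" u]
    by (simp add: free_group_def foldr_cons_reduce_assoc foldr_cons_reduce_Nil)
  ultimately show "\<exists>v\<in>carrier (free_group X). v \<otimes>\<^bsub>free_group X\<^esub> u = \<one>\<^bsub>free_group X\<^esub>"
    by blast
qed (use set_foldr_cons_reduce in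
      \<open>fastforce simp: free_group_def foldr_cons_reduce_assoc intro: reduced_foldr_cons_reduce\<close>)+

datatype gen = Gen_a | Gen_b

abbreviation F2 :: "(gen \<times> bool) list monoid" where
  "F2 \<equiv> free_group {Gen_a, Gen_b}"

definition F2_a :: "(gen \<times> bool) list" where
  "F2_a = [(Gen_a, True)]"

definition F2_b :: "(gen \<times> bool) list" where
  "F2_b = [(Gen_b, True)]"

definition F2_S :: "(gen \<times> bool) list set" where
  "F2_S = {F2_a, inv\<^bsub>F2\<^esub> F2_a, F2_b, inv\<^bsub>F2\<^esub> F2_b}"

text \<open>
  A metric space is a subset \<open>X\<close> of a type of class \<open>metric_space\<close>, with the restricted metric
  and topology.
\<close>

definition dynamical_system ::
    "('g, 'm) monoid_scheme \<Rightarrow> 'x::metric_space set \<Rightarrow> ('g \<Rightarrow> 'x \<Rightarrow> 'x) \<Rightarrow> bool" where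
  "dynamical_system G X \<Phi> \<longleftrightarrow>
     group G \<and>
     continuous_map (prod_topology (discrete_topology (carrier G)) (top_of_set X)) (top_of_set X)
       (\<lambda>(g, x). \<Phi> g x) \<and>
     (\<forall>g\<^sub>1\<in>carrier G. \<forall>g\<^sub>2\<in>carrier G. \<forall>x\<in>X. \<Phi> g\<^sub>1 (\<Phi> g\<^sub>2 x) = \<Phi> (g\<^sub>1 \<otimes>\<^bsub>G\<^esub> g\<^sub>2) x) \<and>
     (\<forall>g\<in>carrier G. homeomorphic_map (top_of_set X) (top_of_set X) (\<Phi> g))"

definition orbit_of :: "('g, 'm) monoid_scheme \<Rightarrow> ('g \<Rightarrow> 'x \<Rightarrow> 'x) \<Rightarrow> 'x \<Rightarrow> 'x set" where
  "orbit_of G \<Phi> x = {\<Phi> g x | g. g \<in> carrier G}"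

definition minimal_set ::
    "('g, 'm) monoid_scheme \<Rightarrow> 'x::metric_space set \<Rightarrow> ('g \<Rightarrow> 'x \<Rightarrow> 'x) \<Rightarrow> 'x set \<Rightarrow> bool" where
  "minimal_set G X \<Phi> M \<longleftrightarrow>
     M \<noteq> {} \<and> M \<subseteq> X \<and> (\<forall>x\<in>M. top_of_set X closure_of orbit_of G \<Phi> x = M)"

definition pseudotrajectory ::
    "('g, 'm) monoid_scheme \<Rightarrow> 'g set \<Rightarrow> 'x::metric_space set \<Rightarrow> ('g \<Rightarrow> 'x \<Rightarrow> 'x) \<Rightarrow> real
      \<Rightarrow> ('g \<Rightarrow> 'x) \<Rightarrow> bool" where
  "pseudotrajectory G S X \<Phi> \<delta> \<xi> \<longleftrightarrow>
     (\<forall>g\<in>carrier G. \<xi> g \<in> X) \<and>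
     (\<forall>g\<in>carrier G. \<forall>s\<in>S. dist (\<Phi> s (\<xi> g)) (\<xi> (s \<otimes>\<^bsub>G\<^esub> g)) < \<delta>)"

definition shadowing_property ::
    "('g, 'm) monoid_scheme \<Rightarrow> 'g set \<Rightarrow> 'x::metric_space set \<Rightarrow> ('g \<Rightarrow> 'x \<Rightarrow> 'x) \<Rightarrow> bool" where
  "shadowing_property G S X \<Phi> \<longleftrightarrow>
     (\<forall>\<epsilon>>0. \<exists>\<delta>>0. \<forall>\<xi>. pseudotrajectory G S X \<Phi> \<delta> \<xi> \<longrightarrow>
        (\<exists>y\<in>X. \<forall>g\<in>carrier G. dist (\<xi> g) (\<Phi> g y) < \<epsilon>))"

text \<open>A Cantor set is a subspace homeomorphic to the countable power of a two-point discrete space.\<close>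

definition cantor_set :: "'x::metric_space set \<Rightarrow> bool" where
  "cantor_set M \<longleftrightarrow>
     top_of_set M homeomorphic_space
       product_topology (\<lambda>_::nat. discrete_topology (UNIV :: bool set)) UNIV"

text \<open>The unit circle carries the metric restricted from the complex plane (chordal distance).\<close>

abbreviation circle :: "complex set" where
  "circle \<equiv> sphere 0 1"

end

theory Submission
  imports Defs
begin

text \<open>
  Let \<open>a\<close> and \<open>b\<close> act by hyperbolic Moebius maps of the unit disc with axes through \<open>1, -1\<close> and
  \<open>\<i>, -\<i>\<close>, translating so far that the four attracting caps are disjoint (a Schottky group). Each
  generator contracts the three caps other than the one of its inverse, so a cap is left by a unique
  expanding generator; the points all of whose images stay in the caps form the minimal Cantor set.

  For shadowing, fix a small pseudotrajectory \<open>\<xi>\<close>. From any vertex \<open>g\<close> of the Cayley tree, the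
  orbit of \<open>\<xi> g\<close> follows \<open>\<xi>\<close> along every branch at \<open>g\<close> that starts with a contraction, i.e. along
  all branches except possibly one. If some vertex has no exceptional branch, its orbit shadows \<open>\<xi>\<close>
  everywhere. Otherwise the exceptional branches form an infinite ray from the identity, the orbit of
  its \<open>n\<close>-th vertex shadows \<open>\<xi>\<close> on the ball of radius \<open>n\<close>, and compactness gives the shadowing point.
\<close>

section \<open>A criterion for Cantor sets\<close>

text \<open>Repeated splitting into non-empty clopen pieces gives a binary tree, and the itinerary
  map is a continuous bijection from a compact onto a Hausdorff space. For injectivity, the
  countable separating family takes the place of shrinking diameters.\<close>

lemma cantor_setI:
  fixes M :: "'a::metric_space set"
  assumes "compact M" "M \<noteq> {}"
    and perfect: "\<And>x. x \<in> M \<Longrightarrow> x islimpt M"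
    and "countable \<U>"
    and clopen: "\<And>U. U \<in> \<U> \<Longrightarrow> closed U \<and> closed (M - U)"
    and separating: "\<And>x y. \<lbrakk>x \<in> M; y \<in> M; x \<noteq> y\<rbrakk> \<Longrightarrow> \<exists>U\<in>\<U>. x \<in> U \<and> y \<notin> U"
  shows "cantor_set M"
proof -
  \<comment> \<open>Compactness of \<open>C\<close> and of its complement expresses that
    \<open>C\<close> is clopen in \<open>M\<close>.\<close>
  define piece where "piece C \<longleftrightarrow> C \<subseteq> M \<and> C \<noteq> {} \<and> compact C \<and> compact (M - C)" for C
  have piece_Int_Diff: "piece (C \<inter> U)" "piece (C - U)"
    if "piece C" "U \<in> \<U>" "C \<inter> U \<noteq> {}" "C - U \<noteq> {}" for C U
  proof -
    have U: "closed U" "closed (M - U)"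
      using clopen that(2) by auto
    have C: "C \<subseteq> M" "compact C" "compact (M - C)"
      using that(1) by (auto simp: piece_def)
    have "compact (M \<inter> U)" "compact (M - U)"
      using U \<open>compact M\<close> compact_Int_closed[OF \<open>compact M\<close>, of "M - U"]
      by (auto simp: compact_Int_closed Int_absorb1)
    moreover have "M - C \<inter> U = (M - C) \<union> (M - U)" "M - (C - U) = (M - C) \<union> (M \<inter> U)"
      "C - U = C \<inter> (M - U)"
      using C(1) by auto
    ultimately show "piece (C \<inter> U)" "piece (C - U)"
      using that C U by (auto simp: piece_def intro: compact_Int_closed compact_Un)
  qed
  obtain x\<^sub>0 y\<^sub>0 where "x\<^sub>0 \<in> M" "y\<^sub>0 \<in> M" "x\<^sub>0 \<noteq> y\<^sub>0"
    using \<open>M \<noteq> {}\<close> perfect by (metis ex_in_conv islimptE open_UNIV UNIV_I)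
  then have "\<U> \<noteq> {}"
    using separating by blast
  define U where "U n = from_nat_into \<U> n" for n
  have range_U: "range U = \<U>"
    using range_from_nat_into[OF \<open>\<U> \<noteq> {}\<close> \<open>countable \<U>\<close>] by (simp add: U_def)
  \<comment> \<open>Cut by \<open>U n\<close> at stage \<open>n\<close> whenever that is a proper cut, so that every pair of points is
    eventually separated.\<close>
  have ex_split: "\<exists>A. piece A \<and> piece (C - A) \<and> A \<subseteq> C \<and> (C \<inter> U n \<noteq> {} \<and> C - U n \<noteq> {} \<longrightarrow> A = C \<inter> U n)"
    if "piece C" for C n
  proof (cases "C \<inter> U n \<noteq> {} \<and> C - U n \<noteq> {}")
    case True
    then show ?thesis
      using piece_Int_Diff[OF that, of "U n"] range_U by (intro exI[of _ "C \<inter> U n"]) (auto simp: Diff_Int)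
  next
    case False
    \<comment> \<open>Here \<open>U n\<close> does not cut \<open>C\<close>. As \<open>C\<close> is
      relatively open and \<open>M\<close> is perfect, \<open>C\<close> has a second point, and a
      set separating the two gives a proper cut.\<close>
    have C: "C \<subseteq> M" "C \<noteq> {}" "closed (M - C)"
      using that by (auto simp: piece_def compact_imp_closed)
    then obtain x where x: "x \<in> C" by blast
    have "x islimpt M" "x \<in> - (M - C)"
      using C x perfect by auto
    moreover have "open (- (M - C))"
      using C(3) by (rule open_Compl)
    ultimately obtain y where y: "y \<in> M" "y \<in> - (M - C)" "y \<noteq> x"
      by (rule islimptE)
    obtain V where V: "V \<in> \<U>" "x \<in> V" "y \<notin> V"
      using separating[of x y] x y C(1) by auto
    then show ?thesis
      using False piece_Int_Diff[OF that V(1)] x y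
      by (intro exI[of _ "C \<inter> V"]) (auto simp: Diff_Int)
  qed
  define split where "split n C = (SOME A. piece A \<and> piece (C - A) \<and> A \<subseteq> C \<and>
    (C \<inter> U n \<noteq> {} \<and> C - U n \<noteq> {} \<longrightarrow> A = C \<inter> U n))" for n C
  have split: "piece (split n C)" "piece (C - split n C)" "split n C \<subseteq> C"
    "C \<inter> U n \<noteq> {} \<Longrightarrow> C - U n \<noteq> {} \<Longrightarrow> split n C = C \<inter> U n" if "piece C" for n C
    using someI_ex[OF ex_split[OF that, of n]] unfolding split_def by blast+
  \<comment> \<open>\<open>branch\<close> descends the tree by prescribed bits, \<open>cell\<close>
    by the pieces containing a given point.\<close>
  define branch :: "(nat \<Rightarrow> bool) \<Rightarrow> nat \<Rightarrow> 'a set" where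
    "branch b = rec_nat M (\<lambda>n C. if b n then split n C else C - split n C)" for b
  define cell where "cell x = rec_nat M (\<lambda>n C. if x \<in> split n C then split n C else C - split n C)" for x
  have branch_simps: "branch b 0 = M"
    "branch b (Suc n) = (if b n then split n (branch b n) else branch b n - split n (branch b n))" for b n
    by (simp_all add: branch_def)
  have cell_simps: "cell x 0 = M"
    "cell x (Suc n) = (if x \<in> split n (cell x n) then split n (cell x n) else cell x n - split n (cell x n))" for x n
    by (simp_all add: cell_def)
  define f where "f x n \<longleftrightarrow> x \<in> split n (cell x n)" for x n
  have "piece M"
    using assms(1,2) by (simp add: piece_def)
  then have piece_branch: "piece (branch b n)" for b n
    by (induction n) (auto simp: branch_simps split)
  have piece_cell: "piece (cell x n)" for x n
    using \<open>piece M\<close> by (induction n) (auto simp: cell_simps split)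
  have in_cell: "x \<in> cell x n" if "x \<in> M" for x n
    using that by (induction n) (auto simp: cell_simps)
  have cell_Suc_subset: "cell x (Suc n) \<subseteq> cell x n" for x n
    using split(3)[OF piece_cell] by (simp add: cell_simps Diff_subset)
  have cell_eq: "cell y n = cell x n" if "y \<in> cell x n" for x y n
    using that
  proof (induction n)
    case (Suc n)
    then have "y \<in> cell x n"
      using cell_Suc_subset by blast
    then show ?case
      using Suc by (auto simp: cell_simps split: if_splits)
  qed (simp add: cell_simps)
  have cell_branch: "cell x n = branch b n" if "\<And>m. m \<le> n \<Longrightarrow> x \<in> branch b m" for x b n
    using that
  proof (induction n)
    case (Suc n)
    then have "cell x n = branch b n" "x \<in> branch b (Suc n)" by simp_all
    then show ?case
      by (auto simp: cell_simps branch_simps split: if_splits)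
  qed (simp add: cell_simps branch_simps)
  have "continuous_map (top_of_set M) (discrete_topology UNIV) (\<lambda>x. f x n)" for n
    unfolding continuous_map_def
  proof (intro conjI allI impI)
    fix V :: "bool set"
    show "openin (top_of_set M) {x \<in> topspace (top_of_set M). f x n \<in> V}"
    proof (subst openin_subopen, intro ballI)
      fix x assume "x \<in> {x \<in> topspace (top_of_set M). f x n \<in> V}"
      then have x: "x \<in> M" "f x n \<in> V" by auto
      \<comment> \<open>This neighbourhood works because all its points share the bits of
        \<open>x\<close> up to index \<open>n\<close>.\<close>
      have "cell x (Suc n) = M \<inter> - (M - cell x (Suc n))" "closed (M - cell x (Suc n))"
        using piece_cell[of x "Suc n"] by (auto simp: piece_def compact_imp_closed)
      then have "openin (top_of_set M) (cell x (Suc n))"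
        by (metis openin_open_Int open_Compl)
      moreover have "f y n \<in> V" if "y \<in> cell x (Suc n)" for y
      proof -
        have "y \<in> cell x n"
          using that cell_Suc_subset by blast
        then show ?thesis
          using x that cell_eq[of y x n] by (auto simp: f_def cell_simps split: if_splits)
      qed
      moreover have "cell x (Suc n) \<subseteq> M"
        using piece_cell by (simp add: piece_def)
      ultimately show "\<exists>T. openin (top_of_set M) T \<and> x \<in> T \<and> T \<subseteq> {x \<in> topspace (top_of_set M). f x n \<in> V}"
        using in_cell[OF x(1)] by (intro exI[of _ "cell x (Suc n)"]) auto
    qed
  qed simp
  then have "continuous_map (top_of_set M) (product_topology (\<lambda>_::nat. discrete_topology (UNIV :: bool set)) UNIV) f"
    by (simp add: continuous_map_componentwise_UNIV)
  moreover have "compact_space (top_of_set M)"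
    using \<open>compact M\<close> compact_space_subtopology compactin_euclidean_iff by blast
  moreover have "Hausdorff_space (product_topology (\<lambda>_::nat. discrete_topology (UNIV :: bool set)) UNIV)"
    by (simp add: Hausdorff_space_product_topology)
  moreover have "f ` M = UNIV"
  proof (intro equalityI subsetI)
    fix b :: "nat \<Rightarrow> bool"
    have dec: "branch b n \<subseteq> branch b m" if "m \<le> n" for m n
      using split(3)[OF piece_branch] by (intro lift_Suc_antimono_le[OF _ that]) (simp add: branch_simps Diff_subset)
    have "M \<inter> \<Inter> (range (branch b)) \<noteq> {}"
    proof (rule compact_imp_fip_image)
      show "compact M" by fact
    next
      show "closed (branch b n)" for n
        using piece_branch by (simp add: piece_def compact_imp_closed)
    next
      fix I :: "nat set" assume "finite I"
      then obtain n where "\<forall>i\<in>I. i \<le> n"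
        using finite_nat_set_iff_bounded_le by auto
      then have "branch b n \<subseteq> M \<inter> \<Inter> (branch b ` I)"
        using dec piece_branch by (auto simp: piece_def)
      then show "M \<inter> \<Inter> (branch b ` I) \<noteq> {}"
        using piece_branch[of b n] unfolding piece_def by blast
    qed
    then obtain x where x: "\<And>n. x \<in> branch b n" by blast
    have "f x n = b n" for n
      using x[of "Suc n"] cell_branch[of n x b] x by (auto simp: f_def branch_simps split: if_splits)
    then show "b \<in> f ` M"
      using x[of 0] by (auto simp: branch_simps intro: rev_image_eqI)
  qed simp
  moreover have "inj_on f M"
  proof (rule inj_onI, rule ccontr)
    fix x y assume xy: "x \<in> M" "y \<in> M" "f x = f y" "x \<noteq> y"
    have f: "x \<in> split n (cell x n) \<longleftrightarrow> y \<in> split n (cell y n)" for n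
      using fun_cong[OF xy(3), of n] by (simp add: f_def)
    have same: "cell x n = cell y n" for n
    proof (induction n)
      case (Suc n)
      then show ?case
        using f[of n] by (simp add: cell_simps)
    qed (simp add: cell_simps)
    \<comment> \<open>At this stage the common cell of \<open>x\<close> and \<open>y\<close> is cut
      properly, hence by \<open>U n\<close> itself, so the bits differ.\<close>
    obtain n where n: "x \<in> U n" "y \<notin> U n"
      using separating[OF xy(1,2,4)] range_U by blast
    have "x \<in> cell x n" "y \<in> cell x n"
      using in_cell xy same by auto
    then have "split n (cell x n) = cell x n \<inter> U n"
      using split(4)[OF piece_cell] n by blast
    then show False
      using n fun_cong[OF xy(3), of n] same[of n] \<open>x \<in> cell x n\<close> by (auto simp: f_def)
  qed
  ultimately have "homeomorphic_map (top_of_set M)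
      (product_topology (\<lambda>_::nat. discrete_topology (UNIV :: bool set)) UNIV) f"
    by (intro continuous_imp_homeomorphic_map) (auto simp: PiE_def)
  then show ?thesis
    unfolding cantor_set_def by (rule homeomorphic_map_imp_homeomorphic_space)
qed

section \<open>Moebius maps of the circle\<close>

text \<open>For \<open>u = dir l\<close>, \<open>moebius l\<close> is the map \<open>z \<mapsto> (z + t * u) / (1 + t * cnj u * z)\<close> with \<open>t = 4/5\<close>; it
  attracts towards \<open>u\<close> and repels from \<open>-u\<close>. As \<open>coord l\<close> is the cosine of the angle to \<open>u\<close>, the caps
  \<open>coord l z \<ge> 17/20\<close> below are disjoint because \<open>17/20\<close> exceeds the cosine of 45 degrees.\<close>

definition dir :: "gen \<times> bool \<Rightarrow> complex" where
  "dir l = (if fst l = Gen_a then 1 else \<i>) * (if snd l then 1 else -1)"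

definition coord :: "gen \<times> bool \<Rightarrow> complex \<Rightarrow> real" where
  "coord l z = Re (cnj (dir l) * z)"

definition moebius :: "gen \<times> bool \<Rightarrow> complex \<Rightarrow> complex" where
  "moebius l z = (5 * z + 4 * dir l) / (5 + 4 * cnj (dir l) * z)"

lemma dir_cnj: "dir l * cnj (dir l) = 1" "cnj (dir l) * dir l = 1"
  by (auto simp: dir_def)

lemma norm_dir [simp]: "norm (dir l) = 1"
  by (auto simp: dir_def norm_mult)

lemma dir_inv_letter [simp]: "dir (inv_letter l) = - dir l"
  by (auto simp: dir_def inv_letter_def)

lemma coord_inv_letter [simp]: "coord (inv_letter l) z = - coord l z"
  by (simp add: coord_def)

lemma inv_letter_neq [simp]: "inv_letter l \<noteq> l" "l \<noteq> inv_letter l"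
  by (auto simp: inv_letter_def prod_eq_iff)

lemma inv_letter_inject [simp]: "inv_letter l = inv_letter m \<longleftrightarrow> l = m"
  by (auto simp: inv_letter_def prod_eq_iff)

lemma finite_letters: "finite (UNIV :: (gen \<times> bool) set)"
proof -
  have "(UNIV :: gen set) = {Gen_a, Gen_b}"
    using gen.exhaust by auto
  then have "finite (UNIV :: gen set)"
    by (metis finite.simps)
  then show ?thesis
    by (simp add: finite_prod)
qed

lemma ex_letter_avoiding3: "\<exists>m :: gen \<times> bool. m \<noteq> l \<and> m \<noteq> k \<and> m \<noteq> j"
proof -
  have "card {l, k, j} < card {(Gen_a, True), (Gen_a, False), (Gen_b, True), (Gen_b, False)}"
    using card_insert_le_m1[of 3 "{k,j}" l] card_insert_le_m1[of 2 "{j}" k] by simp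
  then have "\<not> {(Gen_a, True), (Gen_a, False), (Gen_b, True), (Gen_b, False)} \<subseteq> {l, k, j}"
    by (meson card_mono finite.emptyI finite_insert not_le)
  then show ?thesis by blast
qed

text \<open>The two letters lie on perpendicular axes, so the coordinates are, up to sign, cosine
  and sine of one angle.\<close>

lemma coord_sq_add:
  assumes "norm z = 1" "m \<noteq> l" "m \<noteq> inv_letter l"
  shows "(coord l z)\<^sup>2 + (coord m z)\<^sup>2 = 1"
proof -
  have "fst m \<noteq> fst l"
    using assms(2,3) by (cases m; cases l) (auto simp: inv_letter_def)
  moreover have "(Re z)\<^sup>2 + (Im z)\<^sup>2 = 1"
    using assms(1) cmod_power2[of z] by simp
  ultimately show ?thesis
    by (cases "fst m"; cases "fst l") (auto simp: coord_def dir_def)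
qed

lemma abs_coord_le: "\<bar>coord l z\<bar> \<le> norm z"
  unfolding coord_def using abs_Re_le_cmod[of "cnj (dir l) * z"] by (simp add: norm_mult)

lemma coord_diff_le: "\<bar>coord l p - coord l q\<bar> \<le> dist p q"
  using abs_coord_le[of l "p - q"] by (simp add: coord_def dist_norm algebra_simps)

lemma norm_denominator:
  assumes "norm z = 1"
  shows "(norm (5 + 4 * cnj (dir l) * z))\<^sup>2 = 41 + 40 * coord l z"
proof -
  have "norm (5 + 4 * v) ^ 2 = 41 + 40 * Re v" if "norm v = 1" for v :: complex
  proof -
    have "(Re v)\<^sup>2 + (Im v)\<^sup>2 = 1"
      using that cmod_power2[of v] by simp
    then show ?thesis
      unfolding cmod_power2 by (simp add: power2_eq_square algebra_simps)
  qed
  from this[of "cnj (dir l) * z"] show ?thesis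
    using assms by (simp add: coord_def norm_mult mult.assoc)
qed

lemma norm_denominator_pos:
  assumes "norm z = 1"
  shows "41 + 40 * coord l z > 0"
  using abs_coord_le[of l z] assms by simp

lemma denominator_nonzero:
  assumes "norm z = 1"
  shows "5 + 4 * cnj (dir l) * z \<noteq> 0"
  using norm_denominator[OF assms, of l] norm_denominator_pos[OF assms, of l] by auto

text \<open>Multiplying by \<open>cnj (dir l)\<close> reduces to direction 1, where expanding by the
  conjugate denominator leaves an increasing function of the cosine alone.\<close>

lemma coord_moebius:
  assumes "norm z = 1"
  shows "coord l (moebius l z) = (41 * coord l z + 40) / (41 + 40 * coord l z)"
proof -
  define v where "v = cnj (dir l) * z"
  have nv: "(Re v)\<^sup>2 + (Im v)\<^sup>2 = 1"
    using assms cmod_power2[of v] by (simp add: v_def norm_mult)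
  have "cnj (dir l) * moebius l z = (5 * v + 4) / (5 + 4 * v)"
    using dir_cnj[of l] by (simp add: moebius_def v_def algebra_simps)
  also have "Re \<dots> = Re ((5 * v + 4) * cnj (5 + 4 * v)) / (norm (5 + 4 * v))\<^sup>2"
    by (metis complex_div_cnj Re_divide_of_real of_real_power)
  also have "Re ((5 * v + 4) * cnj (5 + 4 * v)) = 41 * Re v + 20 * ((Re v)\<^sup>2 + (Im v)\<^sup>2) + 20"
    by (simp add: algebra_simps power2_eq_square)
  also have "(norm (5 + 4 * v))\<^sup>2 = 41 + 40 * coord l z"
    using norm_denominator[OF assms, of l] by (simp add: v_def mult.assoc)
  finally show ?thesis
    using nv by (simp add: coord_def v_def)
qed

text \<open>On the unit circle the numerator is \<open>z\<close> times the conjugate of the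
  denominator.\<close>

lemma norm_moebius [simp]:
  assumes "norm z = 1"
  shows "norm (moebius l z) = 1"
proof -
  have "z * cnj z = 1"
    using assms complex_norm_square[of z] by simp
  then have "5 * z + 4 * dir l = z * cnj (5 + 4 * cnj (dir l) * z)"
    by (simp add: algebra_simps)
  then have "norm (5 * z + 4 * dir l) = norm (5 + 4 * cnj (dir l) * z)"
    using assms by (simp add: norm_mult del: complex_cnj_add complex_cnj_mult)
  then show ?thesis
    using denominator_nonzero[OF assms, of l] by (simp add: moebius_def norm_divide)
qed

text \<open>The factor 9 = 25 - 16 is the determinant of the matrix of
  \<open>moebius l\<close>.\<close>

lemma dist_moebius:
  assumes "norm p = 1" "norm q = 1"
  shows "dist (moebius l p) (moebius l q) =
    9 * dist p q / (norm (5 + 4 * cnj (dir l) * p) * norm (5 + 4 * cnj (dir l) * q))"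
proof -
  have "(5 * p + 4 * dir l) * (5 + 4 * cnj (dir l) * q)
      - (5 * q + 4 * dir l) * (5 + 4 * cnj (dir l) * p) = 9 * (p - q)"
    by (auto simp: dir_def algebra_simps)
  then have "moebius l p - moebius l q =
      9 * (p - q) / ((5 + 4 * cnj (dir l) * p) * (5 + 4 * cnj (dir l) * q))"
    using denominator_nonzero[of p l] denominator_nonzero[of q l] assms
    by (simp add: moebius_def diff_frac_eq)
  then show ?thesis
    by (simp only: dist_norm norm_divide norm_mult norm_numeral)
qed

lemma moebius_inv_letter:
  assumes "norm z = 1"
  shows "moebius (inv_letter l) (moebius l z) = z"
proof -
  have nz: "5 + 4 * cnj (dir l) * z \<noteq> 0" "5 + 4 * cnj (dir (inv_letter l)) * moebius l z \<noteq> 0"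
    using denominator_nonzero assms norm_moebius by blast+
  have "5 * moebius l z + 4 * dir (inv_letter l) = 9 * z / (5 + 4 * cnj (dir l) * z)"
    using nz(1) dir_cnj[of l] by (simp add: moebius_def divide_simps) (simp add: algebra_simps)
  moreover have "5 + 4 * cnj (dir (inv_letter l)) * moebius l z = 9 / (5 + 4 * cnj (dir l) * z)"
    using nz(1) dir_cnj[of l] by (simp add: moebius_def divide_simps) (simp add: algebra_simps)
  ultimately show ?thesis
    using nz(1) unfolding moebius_def[of "inv_letter l"] by simp
qed

lemma moebius_inv_letter':
  assumes "norm z = 1"
  shows "moebius l (moebius (inv_letter l) z) = z"
  using moebius_inv_letter[OF assms, of "inv_letter l"] by simp

text \<open>The constants fit since 1 - (7/10)^2 is below (18/25)^2. Asking for 7/10 instead of the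
  cap threshold 17/20 leaves room for the errors of a pseudotrajectory.\<close>

lemma coord_ge_neg:
  assumes "norm z = 1" "coord l z \<ge> 7/10" "m \<noteq> inv_letter l"
  shows "coord m z \<ge> -18/25"
proof (cases "m = l")
  case False
  have "(coord m z)\<^sup>2 = 1 - (coord l z)\<^sup>2"
    using coord_sq_add[OF assms(1) False assms(3)] by simp
  also have "\<dots> \<le> 1 - (7/10)\<^sup>2"
    using assms(2) by (intro diff_left_mono power_mono) auto
  also have "\<dots> \<le> (18/25)\<^sup>2"
    by (simp add: power2_eq_square)
  finally have "\<bar>coord m z\<bar> \<le> 18/25"
    by (metis abs_le_square_iff abs_of_nonneg divide_nonneg_nonneg zero_le_numeral)
  then show ?thesis by simp
qed (use assms in auto)

lemma caps_disjoint:
  assumes "norm z = 1" "coord l z \<ge> 17/20" "coord m z \<ge> 17/20"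
  shows "l = m"
proof (rule ccontr)
  assume "l \<noteq> m"
  moreover have "m \<noteq> inv_letter l"
    using assms by auto
  ultimately have "coord l z ^ 2 + coord m z ^ 2 = 1"
    using coord_sq_add assms by metis
  moreover have "coord l z ^ 2 \<ge> (17/20)\<^sup>2" "coord m z ^ 2 \<ge> (17/20)\<^sup>2"
    using assms by (intro power_mono; simp)+
  ultimately show False
    by (simp add: power2_eq_square)
qed

lemma coord_moebius_ge:
  assumes "norm z = 1" "coord l z \<ge> -18/25"
  shows "coord l (moebius l z) \<ge> 17/20"
  using assms norm_denominator_pos[OF assms(1), of l] by (simp add: coord_moebius field_simps)

text \<open>At -17/20 the formula of \<open>coord_moebius\<close> gives 103/140, about 0.736. This
  bound and the next one enclose that value, which is above 7/10 and below 17/20 with more than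
  3/100 to spare on each side.\<close>

lemma coord_moebius_ge':
  assumes "norm z = 1" "coord l z \<ge> -17/20"
  shows "coord l (moebius l z) \<ge> 73/100"
  using assms norm_denominator_pos[OF assms(1), of l] by (simp add: coord_moebius field_simps)

lemma coord_moebius_le:
  assumes "norm z = 1" "coord l z \<le> -17/20"
  shows "coord l (moebius l z) \<le> 37/50"
  using assms norm_denominator_pos[OF assms(1), of l] by (simp add: coord_moebius field_simps)

text \<open>From -18/25 on, the squared modulus of the denominator is at least 12, so
  \<open>dist_moebius\<close> gives the factor 9/12.\<close>

lemma moebius_contraction:
  assumes "norm p = 1" "norm q = 1" "coord l p \<ge> -18/25" "coord l q \<ge> -18/25"
  shows "dist (moebius l p) (moebius l q) \<le> 3/4 * dist p q"
proof -
  have *: "norm (5 + 4 * cnj (dir l) * z) \<ge> sqrt 12" if "norm z = 1" "coord l z \<ge> -18/25" for z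
    using norm_denominator[OF that(1), of l] that(2) by (intro real_le_lsqrt) auto
  have "12 \<le> norm (5 + 4 * cnj (dir l) * p) * norm (5 + 4 * cnj (dir l) * q)"
    using mult_mono[OF *[OF assms(1,3)] *[OF assms(2,4)]] by simp
  then have "9 * dist p q / (norm (5 + 4 * cnj (dir l) * p) * norm (5 + 4 * cnj (dir l) * q))
      \<le> 9 * dist p q / 12"
    by (intro divide_left_mono) auto
  then show ?thesis
    using assms by (simp add: dist_moebius)
qed

lemma continuous_on_moebius: "continuous_on (sphere 0 1) (moebius l)"
  unfolding moebius_def using denominator_nonzero by (intro continuous_intros) auto

section \<open>The action of the free group\<close>

definition moebius_action :: "(gen \<times> bool) list \<Rightarrow> complex \<Rightarrow> complex" where
  "moebius_action w = foldr moebius w"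

lemma moebius_action_simps [simp]:
  "moebius_action [] z = z"
  "moebius_action (l # w) z = moebius l (moebius_action w z)"
  "moebius_action (v @ w) z = moebius_action v (moebius_action w z)"
  by (simp_all add: moebius_action_def)

lemma norm_moebius_action [simp]: "norm z = 1 \<Longrightarrow> norm (moebius_action w z) = 1"
  by (induction w) auto

lemma moebius_action_cons_reduce:
  assumes "norm z = 1"
  shows "moebius_action (cons_reduce l w) z = moebius l (moebius_action w z)"
proof (cases w)
  case (Cons m v)
  then show ?thesis
    using moebius_inv_letter'[of "moebius_action v z" l] assms by simp
qed simp

lemma moebius_action_foldr_cons_reduce:
  assumes "norm z = 1"
  shows "moebius_action (foldr cons_reduce v w) z = moebius_action v (moebius_action w z)"
  by (induction v) (use assms in \<open>auto simp: moebius_action_cons_reduce\<close>)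

lemma carrier_F2: "carrier F2 = {w. reduced w}"
proof -
  have "x = Gen_a \<or> x = Gen_b" for x
    using gen.exhaust by blast
  then have "set w \<subseteq> {Gen_a, Gen_b} \<times> UNIV" for w :: "(gen \<times> bool) list"
    by auto
  then show ?thesis
    by (simp add: free_group_def)
qed

lemma mult_F2: "u \<otimes>\<^bsub>F2\<^esub> v = foldr cons_reduce u v"
  by (simp add: free_group_def)

lemma one_F2: "\<one>\<^bsub>F2\<^esub> = []"
  by (simp add: free_group_def)

lemma moebius_action_mult:
  "norm z = 1 \<Longrightarrow> moebius_action (u \<otimes>\<^bsub>F2\<^esub> v) z = moebius_action u (moebius_action v z)"
  by (simp add: mult_F2 moebius_action_foldr_cons_reduce)

lemma moebius_action_inv:
  assumes "g \<in> carrier F2" "norm z = 1"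
  shows "moebius_action (inv\<^bsub>F2\<^esub> g) (moebius_action g z) = z"
    and "moebius_action g (moebius_action (inv\<^bsub>F2\<^esub> g) z) = z"
  using assms group.l_inv[OF group_free_group assms(1)] group.r_inv[OF group_free_group assms(1)]
  by (simp_all add: moebius_action_mult[symmetric] one_F2)

lemma inv_F2_singleton: "inv\<^bsub>F2\<^esub> [l] = [inv_letter l]"
proof (rule group.inv_equality[OF group_free_group])
  show "[inv_letter l] \<otimes>\<^bsub>F2\<^esub> [l] = \<one>\<^bsub>F2\<^esub>"
    by (simp add: mult_F2 one_F2)
qed (simp_all add: carrier_F2 reduced_def)

lemma F2_S_eq: "F2_S = range (\<lambda>l. [l])"
proof -
  have "x = (Gen_a, True) \<or> x = (Gen_a, False) \<or> x = (Gen_b, True) \<or> x = (Gen_b, False)" for x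
    by (cases x; cases "fst x"; cases "snd x") auto
  then show ?thesis
    by (auto simp: F2_S_def F2_a_def F2_b_def inv_F2_singleton inv_letter_def)
qed

lemma continuous_on_moebius_action: "continuous_on (sphere 0 1) (moebius_action w)"
proof (induction w)
  case (Cons l w)
  have "continuous_on (sphere 0 1) (moebius l \<circ> moebius_action w)"
    using Cons by (intro continuous_on_compose continuous_on_subset[OF continuous_on_moebius]) auto
  then show ?case
    by (simp add: o_def)
qed (simp add: id_def[symmetric] continuous_on_id)

lemma homeomorphic_map_moebius_action:
  assumes "g \<in> carrier F2"
  shows "homeomorphic_map (top_of_set circle) (top_of_set circle) (moebius_action g)"
proof -
  have "homeomorphic_maps (top_of_set circle) (top_of_set circle)
      (moebius_action g) (moebius_action (inv\<^bsub>F2\<^esub> g))"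
    using moebius_action_inv[OF assms] continuous_on_moebius_action
    by (auto simp: homeomorphic_maps_def)
  then show ?thesis
    using homeomorphic_map_maps by blast
qed

lemma continuous_map_prod_discrete:
  assumes "\<And>g. g \<in> S \<Longrightarrow> continuous_map X Y (f g)"
  shows "continuous_map (prod_topology (discrete_topology S) X) Y (\<lambda>(g, x). f g x)"
  unfolding continuous_map_def
proof (intro conjI allI impI)
  show "(\<lambda>(g, x). f g x) \<in> topspace (prod_topology (discrete_topology S) X) \<rightarrow> topspace Y"
    using assms by (auto simp: continuous_map_def)
next
  fix V assume V: "openin Y V"
  have "{p \<in> topspace (prod_topology (discrete_topology S) X). (case p of (g, x) \<Rightarrow> f g x) \<in> V}
      = (\<Union>g\<in>S. {g} \<times> {x \<in> topspace X. f g x \<in> V})"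
    by auto
  moreover have "openin (prod_topology (discrete_topology S) X) ({g} \<times> {x \<in> topspace X. f g x \<in> V})"
    if "g \<in> S" for g
    using assms[OF that] V that by (auto simp: openin_prod_Times_iff continuous_map_def)
  ultimately show "openin (prod_topology (discrete_topology S) X)
      {p \<in> topspace (prod_topology (discrete_topology S) X). (case p of (g, x) \<Rightarrow> f g x) \<in> V}"
    by auto
qed

lemma dynamical_system_moebius_action: "dynamical_system F2 circle moebius_action"
  unfolding dynamical_system_def
proof (intro conjI ballI)
  show "group F2"
    by (rule group_free_group)
  show "continuous_map (prod_topology (discrete_topology (carrier F2)) (top_of_set circle))
      (top_of_set circle) (\<lambda>(g, x). moebius_action g x)"
    by (intro continuous_map_prod_discrete homeomorphic_imp_continuous_map
        homeomorphic_map_moebius_action)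
qed (simp_all add: moebius_action_mult homeomorphic_map_moebius_action)

section \<open>The limit set\<close>

definition cap :: "gen \<times> bool \<Rightarrow> complex set" where
  "cap l = {z \<in> sphere 0 1. 17/20 \<le> coord l z}"

text \<open>Ranging over all words, not just reduced ones, makes invariance a matter of
  concatenation; \<open>reduce_word\<close> brings the test back to reduced words.\<close>

definition limit_set :: "complex set" where
  "limit_set = {z \<in> sphere 0 1. \<forall>w. moebius_action w z \<in> (\<Union>l. cap l)}"

lemma norm_cap: "z \<in> cap l \<Longrightarrow> norm z = 1"
  by (simp add: cap_def)

lemma norm_limit_set: "z \<in> limit_set \<Longrightarrow> norm z = 1"
  by (simp add: limit_set_def)

lemma cap_unique: "z \<in> cap l \<Longrightarrow> z \<in> cap m \<Longrightarrow> l = m"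
  using caps_disjoint[of z l m] by (simp add: cap_def)

lemma closed_cap: "closed (cap l)"
proof -
  have "cap l = sphere 0 1 \<inter> {z. 17/20 \<le> coord l z}"
    by (auto simp: cap_def)
  moreover have "closed {z. 17/20 \<le> coord l z}"
    unfolding coord_def by (intro closed_Collect_le continuous_intros)
  ultimately show ?thesis
    by (simp add: closed_Int)
qed

text \<open>The ping-pong step: on \<open>cap k\<close> only the direction
  \<open>inv_letter k\<close> has a coordinate below -18/25.\<close>

lemma moebius_mem_cap:
  assumes "z \<in> cap k" "l \<noteq> inv_letter k"
  shows "moebius l z \<in> cap l"
proof -
  have "coord l z \<ge> -18/25"
    using assms by (intro coord_ge_neg[of z k]) (auto simp: cap_def)
  then show ?thesis
    using assms coord_moebius_ge by (auto simp: cap_def)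
qed

lemma moebius_contraction_cap:
  assumes "p \<in> cap k" "q \<in> cap k" "l \<noteq> inv_letter k"
  shows "dist (moebius l p) (moebius l q) \<le> 3/4 * dist p q"
  using assms by (intro moebius_contraction coord_ge_neg[of _ k l]) (auto simp: cap_def)

text \<open>The expanded point reaches at most 37/50, short of 17/20. Hence the caps met by repeated
  expansion spell a reduced word.\<close>

lemma moebius_notin_cap_inv:
  assumes "z \<in> cap k"
  shows "moebius (inv_letter k) z \<notin> cap (inv_letter k)"
  using coord_moebius_le[of z "inv_letter k"] assms by (auto simp: cap_def)

lemma limit_set_memE:
  assumes "z \<in> limit_set"
  obtains l where "z \<in> cap l"
proof -
  have "moebius_action [] z \<in> (\<Union>l. cap l)"
    using assms unfolding limit_set_def by blast
  then show thesis
    using that by auto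
qed

lemma moebius_action_limit_set:
  assumes "z \<in> limit_set"
  shows "moebius_action w z \<in> limit_set"
proof -
  have "moebius_action v (moebius_action w z) \<in> (\<Union>l. cap l)" for v
    using assms moebius_action_simps(3)[of v w z] unfolding limit_set_def
    by (metis (mono_tags, lifting) mem_Collect_eq)
  then show ?thesis
    using assms by (auto simp: limit_set_def)
qed

lemma moebius_limit_set: "z \<in> limit_set \<Longrightarrow> moebius l z \<in> limit_set"
  using moebius_action_limit_set[of z "[l]"] by simp

lemma closed_vimage_moebius_action:
  assumes "closed C"
  shows "closed {z \<in> sphere 0 1. moebius_action w z \<in> C}"
  using continuous_closed_preimage[OF continuous_on_moebius_action _ assms, of w]
  by (simp add: vimage_def Int_def)

lemma closed_limit_set: "closed limit_set"
proof -
  have "limit_set = (\<Inter>w. {z \<in> sphere 0 1. moebius_action w z \<in> (\<Union>l. cap l)})"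
    by (auto simp: limit_set_def)
  moreover have "closed (\<Union>l. cap l)"
    using finite_letters closed_cap by (intro closed_UN) auto
  ultimately have "closed (\<Inter>w. {z \<in> sphere 0 1. moebius_action w z \<in> (\<Union>l. cap l)})"
    by (intro closed_INT ballI closed_vimage_moebius_action)
  then show ?thesis
    using \<open>limit_set = _\<close> by argo
qed

lemma compact_limit_set: "compact limit_set"
proof -
  have "limit_set = sphere 0 1 \<inter> limit_set"
    by (auto simp: limit_set_def)
  then show ?thesis
    using closed_limit_set compact_sphere compact_Int_closed by metis
qed

section \<open>Non-emptiness and minimality of the limit set\<close>

lemma reduce_word:
  assumes "norm z = 1"
  obtains v where "reduced v" "moebius_action v z = moebius_action w z"
proof
  show "reduced (foldr cons_reduce w [])"
    by (rule reduced_foldr_cons_reduce) simp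
  show "moebius_action (foldr cons_reduce w []) z = moebius_action w z"
    using assms by (simp add: moebius_action_foldr_cons_reduce)
qed

lemma one_mem_limit_set: "1 \<in> limit_set"
proof -
  \<comment> \<open>The second disjunct is needed because the inverse of \<open>a\<close> fixes 1, which is in the cap of \<open>a\<close>.\<close>
  have "moebius_action w 1 \<in> cap (hd w) \<or>
      moebius_action w 1 = 1 \<and> (w = [] \<or> hd w = (Gen_a, False))" if "reduced w" for w
    using that
  proof (induction w)
    case (Cons l w)
    have l: "w \<noteq> [] \<Longrightarrow> l \<noteq> inv_letter (hd w)" "reduced w"
      using Cons.prems by (auto simp: reduced_Cons)
    consider "w \<noteq> []" "moebius_action w 1 \<in> cap (hd w)"
      | "moebius_action w 1 = 1" "w = [] \<or> hd w = (Gen_a, False)"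
      using Cons.IH[OF l(2)] by (metis moebius_action_simps(1))
    then show ?case
    proof cases
      case 1
      then show ?thesis
        using moebius_mem_cap[OF 1(2) l(1)[OF 1(1)]] by simp
    next
      case 2
      have "1 \<in> cap (Gen_a, True)"
        by (simp add: cap_def coord_def dir_def)
      moreover have "inv_letter (Gen_a, True) = (Gen_a, False)"
        by (simp add: inv_letter_def)
      ultimately have "l \<noteq> (Gen_a, False) \<Longrightarrow> moebius l 1 \<in> cap l"
        using moebius_mem_cap[of 1 "(Gen_a, True)" l] by argo
      moreover have "moebius (Gen_a, False) 1 = 1"
        by (simp add: moebius_def dir_def)
      ultimately show ?thesis
        using 2(1) by (cases "l = (Gen_a, False)") simp_all
    qed
  qed simp
  moreover have "1 \<in> cap (Gen_a, True)"
    by (simp add: cap_def coord_def dir_def)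
  ultimately have "moebius_action w 1 \<in> (\<Union>l. cap l)" if "reduced w" for w
    using that by (metis UN_I UNIV_I)
  then have "moebius_action w 1 \<in> (\<Union>l. cap l)" for w
    using reduce_word[of 1 w] by (metis norm_one)
  then show ?thesis
    by (simp add: limit_set_def)
qed

text \<open>The letter \<open>m\<close> leads to its cap at once unless it is the inverse of the
  current one; a detour through a third letter \<open>j\<close> settles that case.\<close>

lemma orbit_meets_cap:
  assumes "z \<in> limit_set"
  obtains w where "moebius_action w z \<in> cap m"
proof -
  obtain k where k: "z \<in> cap k"
    using assms by (rule limit_set_memE)
  obtain j where "j \<noteq> k" "j \<noteq> inv_letter k"
    using ex_letter_avoiding3 by blast
  then have "moebius j z \<in> cap j" "moebius m z \<in> cap m \<or> m = inv_letter k"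
    using moebius_mem_cap[OF k] by blast+
  moreover have "moebius m (moebius j z) \<in> cap m" if "m = inv_letter k"
    using that \<open>j \<noteq> k\<close> by (intro moebius_mem_cap[OF \<open>moebius j z \<in> cap j\<close>]) auto
  ultimately show thesis
    using that[of "[m]"] that[of "[m, j]"] by auto
qed

text \<open>The witness \<open>w\<close> is an initial segment of the itinerary of \<open>y\<close> through the caps.\<close>

lemma limit_set_contracting_word:
  assumes "y \<in> limit_set" "y \<in> cap s"
  shows "\<exists>w k. \<forall>p\<in>limit_set - cap k.
    moebius_action w p \<in> cap s \<and> dist (moebius_action w p) y \<le> 2 * (3/4) ^ n"
  using assms
proof (induction n arbitrary: y s)
  case 0
  \<comment> \<open>\<open>cap (inv_letter s)\<close> is the one cap that \<open>s\<close> need not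
    send into \<open>cap s\<close>; 2 is the diameter of the circle.\<close>
  have "moebius s p \<in> cap s \<and> dist (moebius s p) y \<le> 2"
    if "p \<in> limit_set - cap (inv_letter s)" for p
  proof -
    obtain j where "p \<in> cap j"
      using limit_set_memE \<open>p \<in> limit_set - cap (inv_letter s)\<close> by blast
    then have "moebius s p \<in> cap s"
      using that by (intro moebius_mem_cap) auto
    moreover have "dist (moebius s p) y \<le> norm (moebius s p) + norm y"
      by (metis dist_norm norm_triangle_ineq4)
    ultimately show ?thesis
      using 0(2) by (simp add: cap_def)
  qed
  then show ?case
    by (intro exI[of _ "[s]"] exI[of _ "inv_letter s"]) auto
next
  case (Suc n)
  \<comment> \<open>Expanding \<open>y\<close> once removes the first letter of its itinerary;
    applying \<open>s\<close> afterwards restores it and gains a factor 3/4.\<close>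
  define y' where "y' = moebius (inv_letter s) y"
  have y: "moebius s y' = y" "y' \<in> limit_set" "y' \<notin> cap (inv_letter s)"
    unfolding y'_def using moebius_inv_letter'[OF norm_cap[OF Suc.prems(2)]]
      moebius_limit_set[OF Suc.prems(1)] moebius_notin_cap_inv[OF Suc.prems(2)] by blast+
  obtain s' where s': "y' \<in> cap s'"
    using y(2) by (rule limit_set_memE)
  with y(3) have "s \<noteq> inv_letter s'"
    by auto
  obtain w k where wk: "\<And>p. p \<in> limit_set - cap k \<Longrightarrow>
      moebius_action w p \<in> cap s' \<and> dist (moebius_action w p) y' \<le> 2 * (3/4) ^ n"
    using Suc.IH[OF y(2) s'] by blast
  have "moebius s (moebius_action w p) \<in> cap s \<and>
      dist (moebius s (moebius_action w p)) y \<le> 2 * (3/4) ^ Suc n" if "p \<in> limit_set - cap k" for p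
  proof
    have w: "moebius_action w p \<in> cap s'" "dist (moebius_action w p) y' \<le> 2 * (3/4) ^ n"
      using wk[OF that] by (rule conjunct1, rule conjunct2)
    show "moebius s (moebius_action w p) \<in> cap s"
      using moebius_mem_cap[OF w(1) \<open>s \<noteq> inv_letter s'\<close>] .
    show "dist (moebius s (moebius_action w p)) y \<le> 2 * (3/4) ^ Suc n"
    proof -
      have "dist (moebius s (moebius_action w p)) (moebius s y') \<le> 3/4 * dist (moebius_action w p) y'"
        using moebius_contraction_cap[OF w(1) s' \<open>s \<noteq> inv_letter s'\<close>] .
      also have "\<dots> \<le> 3/4 * (2 * (3/4) ^ n)"
        using w(2) by (intro mult_left_mono) auto
      finally show ?thesis
        by (simp add: y(1))
    qed
  qed
  then show ?case
    by (intro exI[of _ "s # w"] exI[of _ k] ballI) (simp only: moebius_action_simps)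
qed

lemma limit_set_approach:
  assumes "y \<in> limit_set" "e > 0"
  obtains w k where "\<And>p. p \<in> limit_set - cap k \<Longrightarrow> dist (moebius_action w p) y < e"
proof -
  obtain s where s: "y \<in> cap s"
    using assms(1) by (rule limit_set_memE)
  obtain n where "(3/4 :: real) ^ n < e / 2"
    using real_arch_pow_inv[of "e / 2" "3/4"] assms(2) by auto
  then have n: "2 * (3/4 :: real) ^ n < e"
    by simp
  obtain w k where "\<forall>p\<in>limit_set - cap k.
      moebius_action w p \<in> cap s \<and> dist (moebius_action w p) y \<le> 2 * (3/4) ^ n"
    using limit_set_contracting_word[OF assms(1) s] by blast
  then have "dist (moebius_action w p) y < e" if "p \<in> limit_set - cap k" for p
    using that n by (meson le_less_trans)
  then show thesis
    using that by blast
qed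

text \<open>One word brings all limit points outside a single cap \<open>k\<close> close to
  \<open>y\<close>, and every orbit in the limit set visits the cap opposite to
  \<open>k\<close>.\<close>

lemma minimal_limit_set: "minimal_set F2 circle moebius_action limit_set"
  unfolding minimal_set_def
proof (intro conjI ballI)
  show "limit_set \<noteq> {}"
    using one_mem_limit_set by blast
  show "limit_set \<subseteq> circle"
    by (auto simp: limit_set_def)
  fix x assume x: "x \<in> limit_set"
  define Orb where "Orb = orbit_of F2 moebius_action x"
  have in_Orb: "moebius_action w x \<in> Orb" for w
  proof -
    obtain v where "reduced v" "moebius_action v x = moebius_action w x"
      using norm_limit_set[OF x] by (rule reduce_word)
    then show ?thesis
      unfolding Orb_def orbit_of_def carrier_F2 by (metis (mono_tags, lifting) mem_Collect_eq)
  qed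
  have Orb_subset: "Orb \<subseteq> limit_set"
    using moebius_action_limit_set[OF x] by (auto simp: Orb_def orbit_of_def)
  have "limit_set \<subseteq> closure Orb"
  proof
    fix y assume y: "y \<in> limit_set"
    have "\<exists>p\<in>Orb. dist p y < e" if e: "e > 0" for e
    proof -
      obtain w k where wk: "\<And>p. p \<in> limit_set - cap k \<Longrightarrow> dist (moebius_action w p) y < e"
        using limit_set_approach[OF y e] by metis
      obtain v where v: "moebius_action v x \<in> cap (inv_letter k)"
        using orbit_meets_cap[OF x] by metis
      then have "moebius_action v x \<in> limit_set - cap k"
        using cap_unique[OF v, of k] moebius_action_limit_set[OF x] by auto
      from wk[OF this] have "dist (moebius_action (w @ v) x) y < e"
        by simp
      then show ?thesis
        using in_Orb by blast
    qed
    then show "y \<in> closure Orb"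
      by (simp add: closure_approachable)
  qed
  moreover have "closure Orb \<subseteq> limit_set"
    using closed_limit_set Orb_subset closure_minimal by blast
  moreover have "top_of_set circle closure_of Orb = circle \<inter> closure Orb"
    using Orb_subset \<open>limit_set \<subseteq> circle\<close>
    by (simp add: closure_of_subtopology Int_absorb1 subset_trans)
  ultimately show "top_of_set circle closure_of orbit_of F2 moebius_action x = limit_set"
    using \<open>limit_set \<subseteq> circle\<close> by (auto simp: Orb_def)
qed

section \<open>Perfectness of the limit set and separation of its points\<close>

lemma inj_moebius_action:
  assumes "norm p = 1" "norm q = 1" "moebius_action w p = moebius_action w q"
  shows "p = q"
  using assms
proof (induction w)
  case (Cons l w)
  have "moebius_action w p = moebius_action w q"
    using Cons.prems by (metis moebius_action_simps(2) moebius_inv_letter norm_moebius_action)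
  then show ?case
    using Cons by blast
qed simp

text \<open>Two distinct limit points outside \<open>cap k\<close> are moved close to
  \<open>y\<close> by the same word; by injectivity at most one image is \<open>y\<close>.\<close>

lemma limit_set_islimpt:
  assumes "y \<in> limit_set"
  shows "y islimpt limit_set"
  unfolding islimpt_approachable
proof (intro allI impI)
  fix e :: real assume "e > 0"
  then obtain w k where wk: "\<And>p. p \<in> limit_set - cap k \<Longrightarrow> dist (moebius_action w p) y < e"
    using limit_set_approach[OF assms] by metis
  obtain m where m: "m \<noteq> k" "m \<noteq> inv_letter k"
    using ex_letter_avoiding3 by blast
  obtain v v' where v: "moebius_action v y \<in> cap m" "moebius_action v' y \<in> cap (inv_letter k)"
    using orbit_meets_cap[OF assms] by metis
  define p q where "p = moebius_action v y" and "q = moebius_action v' y"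
  have p: "p \<in> limit_set" "p \<in> cap m" and q: "q \<in> limit_set" "q \<in> cap (inv_letter k)"
    using v moebius_action_limit_set[OF assms] by (simp_all add: p_def q_def)
  have "p \<noteq> q" "p \<notin> cap k" "q \<notin> cap k"
    using p q m cap_unique inv_letter_neq by metis+
  then have "moebius_action w p \<noteq> moebius_action w q"
    using inj_moebius_action[of p q w] p q norm_limit_set by blast
  moreover have "dist (moebius_action w p) y < e" "dist (moebius_action w q) y < e"
    using wk p q \<open>p \<notin> cap k\<close> \<open>q \<notin> cap k\<close> by simp_all
  moreover have "moebius_action w p \<in> limit_set" "moebius_action w q \<in> limit_set"
    using moebius_action_limit_set p q by simp_all
  ultimately show "\<exists>x'\<in>limit_set. x' \<noteq> y \<and> dist x' y < e"
    by metis
qed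

text \<open>Expansivity: if no word separated the points, repeated expansion would stretch their
  distance by at least 4/3 at each step, beyond the diameter 2.\<close>

lemma limit_set_separated:
  assumes "x \<in> limit_set" "y \<in> limit_set" "x \<noteq> y"
  shows "\<exists>w l. moebius_action w x \<in> cap l \<and> moebius_action w y \<notin> cap l"
proof (rule ccontr)
  assume "\<not> ?thesis"
  then have same: "moebius_action w y \<in> cap l" if "moebius_action w x \<in> cap l" for w l
    using that by blast
  have "\<exists>w. dist x y \<le> (3/4) ^ n * dist (moebius_action w x) (moebius_action w y)" for n
  proof (induction n)
    case 0
    show ?case
      by (rule exI[of _ "[]"]) simp
  next
    case (Suc n)
    then obtain w where w: "dist x y \<le> (3/4) ^ n * dist (moebius_action w x) (moebius_action w y)"
      by blast
    define p q where "p = moebius_action w x" and "q = moebius_action w y"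
    have pq: "p \<in> limit_set" "q \<in> limit_set"
      using moebius_action_limit_set assms by (auto simp: p_def q_def)
    obtain s where s: "p \<in> cap s"
      using pq(1) by (rule limit_set_memE)
    obtain t where t: "moebius (inv_letter s) p \<in> cap t"
      using limit_set_memE moebius_limit_set[OF pq(1)] by metis
    then have "moebius (inv_letter s) q \<in> cap t"
      using same[of "inv_letter s # w" t] by (simp add: p_def q_def)
    moreover have "s \<noteq> inv_letter t"
      using t moebius_notin_cap_inv[OF s] by auto
    ultimately have "dist (moebius s (moebius (inv_letter s) p)) (moebius s (moebius (inv_letter s) q))
        \<le> 3/4 * dist (moebius (inv_letter s) p) (moebius (inv_letter s) q)"
      using moebius_contraction_cap t by blast
    then have "dist p q \<le> 3/4 * dist (moebius (inv_letter s) p) (moebius (inv_letter s) q)"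
      using pq norm_limit_set by (simp add: moebius_inv_letter')
    then have "(3/4) ^ n * dist p q
        \<le> (3/4) ^ n * (3/4 * dist (moebius (inv_letter s) p) (moebius (inv_letter s) q))"
      by (intro mult_left_mono) auto
    also have "\<dots> = (3/4) ^ Suc n *
        dist (moebius_action (inv_letter s # w) x) (moebius_action (inv_letter s # w) y)"
      by (simp only: power_Suc mult_ac p_def q_def moebius_action_simps)
    finally show ?case
      using w order_trans unfolding p_def q_def by blast
  qed
  moreover have "dist (moebius_action w x) (moebius_action w y) \<le> 2" for w
    using norm_triangle_ineq4[of "moebius_action w x" "moebius_action w y"] assms norm_limit_set
    by (simp add: dist_norm)
  ultimately have *: "dist x y \<le> (3/4) ^ n * 2" for n
    by (meson mult_left_mono order_trans zero_le_divide_iff zero_le_numeral zero_le_power)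
  obtain n where "(3/4 :: real) ^ n < dist x y / 2"
    using real_arch_pow_inv[of "dist x y / 2" "3/4"] assms(3) by auto
  then show False
    using *[of n] by simp
qed

lemma cantor_limit_set: "cantor_set limit_set"
proof -
  define cyl where "cyl p = limit_set \<inter> {z \<in> sphere 0 1. moebius_action (fst p) z \<in> cap (snd p)}" for p
  have mem_cyl: "z \<in> cyl (w, l) \<longleftrightarrow> moebius_action w z \<in> cap l" if "z \<in> limit_set" for z w l
    using that norm_limit_set[of z] by (simp add: cyl_def)
  show ?thesis
  proof (rule cantor_setI)
    have letters: "countable (UNIV :: (gen \<times> bool) set)"
      using finite_letters by (rule countable_finite)
    have "countable (UNIV :: (gen \<times> bool) list set)"
      using countable_lists[OF letters] by simp
    then have "countable ((UNIV :: (gen \<times> bool) list set) \<times> (UNIV :: (gen \<times> bool) set))"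
      using letters by (intro countable_SIGMA)
    then show "countable (range cyl)"
      by (simp add: countable_image)
  next
    fix U assume "U \<in> range cyl"
    then obtain w l where U: "U = cyl (w, l)"
      by (metis imageE surj_pair)
    \<comment> \<open>For limit points, avoiding \<open>cap l\<close> means lying in one of the
      finitely many other caps, a closed condition.\<close>
    have "limit_set - U = limit_set \<inter> {z \<in> sphere 0 1. moebius_action w z \<in> (\<Union>m\<in>- {l}. cap m)}"
    proof (intro equalityI subsetI)
      fix z assume z: "z \<in> limit_set - U"
      then obtain m where m: "moebius_action w z \<in> cap m"
        using limit_set_memE[OF moebius_action_limit_set, of z w] by blast
      then have "m \<noteq> l"
        using z mem_cyl U by blast
      with m z show "z \<in> limit_set \<inter> {z \<in> sphere 0 1. moebius_action w z \<in> (\<Union>m\<in>- {l}. cap m)}"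
        using norm_limit_set[of z] by (simp, blast)
    next
      fix z assume "z \<in> limit_set \<inter> {z \<in> sphere 0 1. moebius_action w z \<in> (\<Union>m\<in>- {l}. cap m)}"
      then obtain m where "z \<in> limit_set" "m \<noteq> l" "moebius_action w z \<in> cap m"
        by blast
      then show "z \<in> limit_set - U"
        using cap_unique[of "moebius_action w z" m l] mem_cyl U by blast
    qed
    moreover have "closed (\<Union>m\<in>- {l}. cap m)"
      by (rule closed_UN[OF finite_subset[OF subset_UNIV finite_letters]]) (simp add: closed_cap)
    ultimately have "closed (limit_set - U)"
      using closed_Int[OF closed_limit_set closed_vimage_moebius_action] by presburger
    moreover have "closed U"
      unfolding U cyl_def by (intro closed_Int closed_limit_set closed_vimage_moebius_action closed_cap)
    ultimately show "closed U \<and> closed (limit_set - U)"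
      by blast
  next
    fix x y assume xy: "x \<in> limit_set" "y \<in> limit_set" "x \<noteq> y"
    then obtain w l where "moebius_action w x \<in> cap l" "moebius_action w y \<notin> cap l"
      using limit_set_separated by blast
    then have "x \<in> cyl (w, l)" "y \<notin> cyl (w, l)"
      using xy mem_cyl by simp_all
    then show "\<exists>U\<in>range cyl. x \<in> U \<and> y \<notin> U"
      by blast
  next
    show "limit_set \<noteq> {}"
      using one_mem_limit_set by blast
  qed (fact compact_limit_set limit_set_islimpt)+
qed

section \<open>Shadowing\<close>

lemma reduced_snoc:
  "reduced (w @ [l]) \<longleftrightarrow> reduced w \<and> (w \<noteq> [] \<longrightarrow> l \<noteq> inv_letter (last w))"
proof (induction w)
  case (Cons m w)
  then show ?case
    by (cases w) (simp_all add: reduced_Cons, blast)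
qed (simp add: reduced_Cons)

lemma reduced_append_Cons:
  assumes "reduced (u @ [l])" "reduced (l # v)"
  shows "reduced (u @ l # v)"
  using assms(1)
proof (induction u)
  case (Cons m u)
  then show ?case
    by (cases u) (simp_all add: reduced_Cons)
qed (use assms(2) in simp)

lemma foldr_cons_reduce_append: "reduced (u @ v) \<Longrightarrow> foldr cons_reduce u v = u @ v"
proof (induction u)
  case (Cons l u)
  then show ?case
    by (cases "u @ v") (simp_all add: reduced_Cons)
qed simp

text \<open>\<open>w\<close> and \<open>l # h\<close> overlap in the letter \<open>l\<close>, so
  nothing cancels in the product. It serves to show that the exceptional branch at the end of the
  ray leaves the ball.\<close>

lemma length_mult_ge:
  assumes "reduced w" "w \<noteq> []" "last w = l" "reduced (l # h)"
  shows "length (foldr cons_reduce w h) > length h"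
proof -
  obtain u where u: "w = u @ [l]"
    using assms(2,3) by (metis append_butlast_last_id)
  have "cons_reduce l h = l # h"
    using assms(4) by (cases h) (simp_all add: reduced_Cons)
  then have "foldr cons_reduce w h = u @ l # h"
    using foldr_cons_reduce_append[OF reduced_append_Cons[of u l h]] assms(1,4) u by simp
  then show ?thesis
    by simp
qed

text \<open>The limit 3/100 suits the caps: 73/100 - 3/100 = 7/10 keeps contraction available, and
  37/50 + 3/100 stays below 17/20.\<close>

locale moebius_pseudotrajectory =
  fixes \<delta> :: real and \<xi> :: "(gen \<times> bool) list \<Rightarrow> complex"
  assumes pseudotrajectory: "pseudotrajectory F2 F2_S circle moebius_action \<delta> \<xi>"
    and \<delta>_pos: "0 < \<delta>" and \<delta>_small: "\<delta> \<le> 3/100"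
begin

lemma norm_\<xi>: "reduced g \<Longrightarrow> norm (\<xi> g) = 1"
  using pseudotrajectory by (simp add: pseudotrajectory_def carrier_F2)

lemma dist_step:
  assumes "reduced g"
  shows "dist (moebius l (\<xi> g)) (\<xi> (cons_reduce l g)) < \<delta>"
proof -
  have "dist (moebius_action [l] (\<xi> g)) (\<xi> ([l] \<otimes>\<^bsub>F2\<^esub> g)) < \<delta>"
    using pseudotrajectory assms unfolding pseudotrajectory_def carrier_F2 F2_S_eq by blast
  then show ?thesis
    by (simp add: mult_F2)
qed

text \<open>The bound is the fixed point of \<open>x \<mapsto> \<delta> + 3/4 * x\<close>: each further letter contracts by
  \<open>3/4\<close>, because a reduced word never applies the inverse of the letter whose cap the orbit is in.\<close>

lemma shadowed_along_words:
  assumes g: "reduced g" and z: "norm z = 1" "dist (\<xi> g) z \<le> 4 * \<delta>"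
    and l: "coord l (\<xi> g) \<ge> 7/10" "coord l z \<ge> 7/10"
    and w: "reduced (w @ [l])"
  shows "dist (\<xi> (foldr cons_reduce w g)) (moebius_action w z) \<le> 4 * \<delta>"
proof -
  \<comment> \<open>The coordinates are carried along so that the next letter contracts at both
    points; \<open>hd (w @ [l])\<close> is the letter applied last, or \<open>l\<close> when
    \<open>w\<close> is empty.\<close>
  have "dist (\<xi> (foldr cons_reduce w g)) (moebius_action w z) \<le> 4 * \<delta> \<and>
    coord (hd (w @ [l])) (\<xi> (foldr cons_reduce w g)) \<ge> 7/10 \<and>
    coord (hd (w @ [l])) (moebius_action w z) \<ge> 7/10"
    using w
  proof (induction w)
    case Nil
    then show ?case
      using z l by simp
  next
    case (Cons m w)
    define k where "k = hd (w @ [l])"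
    define p q p' where "p = \<xi> (foldr cons_reduce w g)" and "q = moebius_action w z"
      and "p' = \<xi> (cons_reduce m (foldr cons_reduce w g))"
    have red: "reduced (w @ [l])" "m \<noteq> inv_letter k"
      using Cons.prems unfolding k_def by (auto simp: reduced_Cons)
    have IH: "dist p q \<le> 4 * \<delta>" "coord k p \<ge> 7/10" "coord k q \<ge> 7/10"
      using Cons.IH[OF red(1)] unfolding p_def q_def k_def by blast+
    have reduced: "reduced (foldr cons_reduce w g)"
      using g by (rule reduced_foldr_cons_reduce)
    have norm: "norm p = 1" "norm q = 1"
      using norm_\<xi>[OF reduced] z(1) by (simp_all add: p_def q_def)
    have step: "dist (moebius m p) p' < \<delta>"
      using dist_step[OF reduced] by (simp add: p_def p'_def)
    have neg: "coord m p \<ge> -18/25" "coord m q \<ge> -18/25"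
      using coord_ge_neg norm IH red(2) by blast+
    have "dist p' (moebius m q) \<le> dist (moebius m p) p' + dist (moebius m p) (moebius m q)"
      by (rule dist_triangle3)
    also have "\<dots> \<le> \<delta> + 3/4 * (4 * \<delta>)"
      using step moebius_contraction[OF norm neg] IH(1) by linarith
    finally have "dist p' (moebius m q) \<le> 4 * \<delta>"
      by simp
    moreover have "coord m p' \<ge> 7/10"
      using coord_diff_le[of m "moebius m p" p'] step coord_moebius_ge[OF norm(1) neg(1)] \<delta>_small
      by linarith
    moreover have "coord m (moebius m q) \<ge> 7/10"
      using coord_moebius_ge[OF norm(2) neg(2)] by linarith
    ultimately show ?case
      by (simp add: p'_def q_def)
  qed
  then show ?thesis ..
qed

text \<open>Words act by their last letter first, so \<open>reduced (w @ [l])\<close> excludes just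
  the branch at \<open>g\<close> that starts by expanding \<open>cap l\<close>.\<close>

lemma shadowed_from_cap:
  assumes "reduced g" "\<xi> g \<in> cap l" "reduced (w @ [l])"
  shows "dist (\<xi> (foldr cons_reduce w g)) (moebius_action w (\<xi> g)) \<le> 4 * \<delta>"
  using assms norm_\<xi>[OF assms(1)] \<delta>_pos
  by (intro shadowed_along_words) (simp_all add: cap_def)

text \<open>Any first letter lifts its coordinate to at least 73/100, hence at least 7/10 after the
  error. \<open>shadowed_along_words\<close> then starts one step later, from a distance below
  \<open>\<delta>\<close>.\<close>

lemma shadowed_from_gap:
  assumes g: "reduced g" and gap: "\<And>l. \<xi> g \<notin> cap l" and w: "reduced w"
  shows "dist (\<xi> (foldr cons_reduce w g)) (moebius_action w (\<xi> g)) \<le> 4 * \<delta>"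
proof (cases w rule: rev_cases)
  case Nil
  then show ?thesis
    using \<delta>_pos by simp
next
  case (snoc v l)
  have "coord (inv_letter l) (\<xi> g) < 17/20"
    using gap[of "inv_letter l"] norm_\<xi>[OF g] by (simp add: cap_def)
  then have "coord l (moebius l (\<xi> g)) \<ge> 73/100"
    using coord_moebius_ge'[OF norm_\<xi>[OF g], of l] by simp
  moreover have "dist (moebius l (\<xi> g)) (\<xi> (cons_reduce l g)) < \<delta>"
    using g by (rule dist_step)
  moreover have "\<bar>coord l (moebius l (\<xi> g)) - coord l (\<xi> (cons_reduce l g))\<bar>
      \<le> dist (moebius l (\<xi> g)) (\<xi> (cons_reduce l g))"
    by (rule coord_diff_le)
  ultimately have "dist (\<xi> (foldr cons_reduce v (cons_reduce l g)))
      (moebius_action v (moebius l (\<xi> g))) \<le> 4 * \<delta>"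
    using w snoc norm_\<xi>[OF g] \<delta>_small \<delta>_pos
    by (intro shadowed_along_words[where l = l] reduced_cons_reduce g) (simp_all add: dist_commute)
  then show ?thesis
    by (simp add: snoc)
qed

text \<open>This keeps the ray of exceptional branches from turning back.\<close>

lemma next_cap_no_backtrack:
  assumes "reduced g" "\<xi> g \<in> cap l"
  shows "\<xi> (cons_reduce (inv_letter l) g) \<notin> cap (inv_letter l)"
proof -
  have "coord (inv_letter l) (moebius (inv_letter l) (\<xi> g)) \<le> 37/50"
    using assms norm_\<xi>[OF assms(1)] by (intro coord_moebius_le) (simp_all add: cap_def)
  then have "coord (inv_letter l) (\<xi> (cons_reduce (inv_letter l) g)) < 17/20"
    using coord_diff_le[of "inv_letter l" "moebius (inv_letter l) (\<xi> g)" "\<xi> (cons_reduce (inv_letter l) g)"]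
      dist_step[OF assms(1), of "inv_letter l"] \<delta>_small by linarith
  then show ?thesis
    by (simp add: cap_def)
qed

text \<open>The product of \<open>g\<close> and the inverse of \<open>h\<close> is the path from
  \<open>h\<close> to \<open>g\<close>, so an orbit can be read from \<open>h\<close> instead of
  from the identity.\<close>

lemma translate_vertex:
  assumes "reduced g" "reduced h"
  obtains w where "reduced w" "foldr cons_reduce w h = g"
    "\<And>z. norm z = 1 \<Longrightarrow> moebius_action g (moebius_action (inv\<^bsub>F2\<^esub> h) z) = moebius_action w z"
proof
  interpret F2: group F2
    by (rule group_free_group)
  let ?w = "g \<otimes>\<^bsub>F2\<^esub> inv\<^bsub>F2\<^esub> h"
  have gh: "g \<in> carrier F2" "h \<in> carrier F2"
    using assms by (simp_all add: carrier_F2)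
  then have "?w \<in> carrier F2"
    by simp
  then show "reduced ?w"
    by (simp only: carrier_F2 mem_Collect_eq)
  have "?w \<otimes>\<^bsub>F2\<^esub> h = g"
    using gh by (simp add: F2.m_assoc)
  then show "foldr cons_reduce ?w h = g"
    by (simp only: mult_F2)
  show "moebius_action g (moebius_action (inv\<^bsub>F2\<^esub> h) z) = moebius_action ?w z" if "norm z = 1" for z
    using moebius_action_mult[OF that, of g "inv\<^bsub>F2\<^esub> h"] by simp
qed

lemma shadowed_on_ball:
  "\<exists>y\<in>circle. \<forall>g. reduced g \<and> length g \<le> n \<longrightarrow> dist (\<xi> g) (moebius_action g y) \<le> 4 * \<delta>"
proof (cases "\<exists>h. reduced h \<and> (\<forall>l. \<xi> h \<notin> cap l)")
  case True
  then obtain h where h: "reduced h" "\<And>l. \<xi> h \<notin> cap l"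
    by blast
  show ?thesis
  proof (intro bexI allI impI)
    fix g :: "(gen \<times> bool) list" assume "reduced g \<and> length g \<le> n"
    then obtain w where w: "reduced w" "foldr cons_reduce w h = g"
      "\<And>z. norm z = 1 \<Longrightarrow> moebius_action g (moebius_action (inv\<^bsub>F2\<^esub> h) z) = moebius_action w z"
      using translate_vertex[OF _ h(1)] by blast
    show "dist (\<xi> g) (moebius_action g (moebius_action (inv\<^bsub>F2\<^esub> h) (\<xi> h))) \<le> 4 * \<delta>"
      using shadowed_from_gap[OF h w(1)] w(2,3) norm_\<xi>[OF h(1)] by simp
  qed (use norm_\<xi>[OF h(1)] in simp)
next
  case False
  define \<sigma> where "\<sigma> h = (SOME l. \<xi> h \<in> cap l)" for h
  have \<sigma>: "\<xi> h \<in> cap (\<sigma> h)" if "reduced h" for h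
    using False that someI_ex[of "\<lambda>l. \<xi> h \<in> cap l"] unfolding \<sigma>_def by blast
  \<comment> \<open>Each vertex is prolonged along the only branch on which shadowing by its orbit
    may fail.\<close>
  define h where "h = rec_nat [] (\<lambda>n v. inv_letter (\<sigma> v) # v)"
  have h_simps: "h 0 = []" "h (Suc n) = inv_letter (\<sigma> (h n)) # h n" for n
    by (simp_all add: h_def)
  have length_h: "length (h n) = n" for n
    by (induction n) (simp_all add: h_simps)
  \<comment> \<open>Stated for \<open>h (Suc n)\<close>, so that the induction hypothesis already
    says that adding the new letter cancels nothing.\<close>
  have reduced_Suc: "reduced (h (Suc n))" for n
  proof (induction n)
    case (Suc n)
    have hn: "reduced (h n)"
      using Suc by (simp add: h_simps reduced_Cons)
    have "cons_reduce (inv_letter (\<sigma> (h n))) (h n) = h (Suc n)"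
      using Suc by (cases "h n") (simp_all add: h_simps reduced_Cons)
    then have "\<xi> (h (Suc n)) \<notin> cap (inv_letter (\<sigma> (h n)))"
      using next_cap_no_backtrack[OF hn \<sigma>[OF hn]] by simp
    then have "\<sigma> (h (Suc n)) \<noteq> inv_letter (\<sigma> (h n))"
      using \<sigma>[OF Suc] by auto
    then have "inv_letter (\<sigma> (h n)) \<noteq> inv_letter (inv_letter (\<sigma> (h (Suc n))))"
      by simp
    then show ?case
      using Suc by (simp add: h_simps(2)[of "Suc n"] reduced_Cons) (simp add: h_simps)
  qed (simp add: h_simps reduced_Cons)
  have hn: "reduced (h n)"
    using reduced_Suc[of n] by (simp add: h_simps reduced_Cons)
  show ?thesis
  proof (intro bexI allI impI)
    fix g :: "(gen \<times> bool) list" assume g: "reduced g \<and> length g \<le> n"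
    then obtain w where w: "reduced w" "foldr cons_reduce w (h n) = g"
      "\<And>z. norm z = 1 \<Longrightarrow> moebius_action g (moebius_action (inv\<^bsub>F2\<^esub> h n) z) = moebius_action w z"
      using translate_vertex[OF _ hn] by blast
    \<comment> \<open>Otherwise \<open>g\<close> would lie beyond \<open>h n\<close> on the
      exceptional branch and be longer than \<open>n\<close>.\<close>
    have "reduced (w @ [\<sigma> (h n)])"
    proof (rule ccontr)
      assume "\<not> ?thesis"
      then have "w \<noteq> []" "last w = inv_letter (\<sigma> (h n))"
        using w(1) by (auto simp: reduced_snoc)
      then have "length (foldr cons_reduce w (h n)) > length (h n)"
        using length_mult_ge[OF w(1)] reduced_Suc[of n] by (simp add: h_simps)
      then show False
        using g w(2) length_h by simp
    qed
    then show "dist (\<xi> g) (moebius_action g (moebius_action (inv\<^bsub>F2\<^esub> h n) (\<xi> (h n)))) \<le> 4 * \<delta>"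
      using shadowed_from_cap[OF hn \<sigma>[OF hn], of w] w(2,3) norm_\<xi>[OF hn] by simp
  qed (use norm_\<xi>[OF hn] in simp)
qed

text \<open>The bound does not depend on the radius, so a limit of the points found for growing
  balls inherits it at each \<open>g\<close>.\<close>

lemma shadowed: "\<exists>y\<in>circle. \<forall>g. reduced g \<longrightarrow> dist (\<xi> g) (moebius_action g y) \<le> 4 * \<delta>"
proof -
  obtain y where y: "\<And>n. y n \<in> circle"
    "\<And>n g. reduced g \<Longrightarrow> length g \<le> n \<Longrightarrow> dist (\<xi> g) (moebius_action g (y n)) \<le> 4 * \<delta>"
    using shadowed_on_ball by metis
  have "compact circle"
    by (rule compact_sphere)
  then obtain x r where x: "x \<in> circle" "strict_mono r" "(y \<circ> r) \<longlonglongrightarrow> x"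
    using y(1) unfolding compact_def by blast
  have "dist (\<xi> g) (moebius_action g x) \<le> 4 * \<delta>" if g: "reduced g" for g
  proof (rule LIMSEQ_le_const2)
    have "(\<lambda>n. y (r n)) \<longlonglongrightarrow> x"
      using x(3) by (simp add: o_def)
    then have "(\<lambda>n. moebius_action g (y (r n))) \<longlonglongrightarrow> moebius_action g x"
      using x(1)
      by (rule continuous_on_tendsto_compose[OF continuous_on_moebius_action]) (use y(1) in simp)
    then show "(\<lambda>n. dist (\<xi> g) (moebius_action g (y (r n)))) \<longlonglongrightarrow> dist (\<xi> g) (moebius_action g x)"
      by (intro tendsto_intros) simp
    \<comment> \<open>Any \<open>N\<close> at least \<open>length g\<close> works, as
      \<open>r n\<close> is at least \<open>n\<close>.\<close>
    show "\<exists>N. \<forall>n\<ge>N. dist (\<xi> g) (moebius_action g (y (r n))) \<le> 4 * \<delta>"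
      using y(2)[OF g] seq_suble[OF x(2)] by (meson order_trans)
  qed
  then show ?thesis
    using x(1) by blast
qed

end

lemma shadowing_moebius_action: "shadowing_property F2 F2_S circle moebius_action"
  unfolding shadowing_property_def
proof (intro allI impI)
  fix \<epsilon> :: real assume "\<epsilon> > 0"
  \<comment> \<open>Dividing by 5 rather than 4 makes \<open>4 * \<delta>\<close> strictly smaller
    than \<open>\<epsilon>\<close>.\<close>
  define \<delta> where "\<delta> = min (3/100) (\<epsilon> / 5)"
  have \<delta>: "0 < \<delta>" "\<delta> \<le> 3/100" "4 * \<delta> < \<epsilon>"
    using \<open>\<epsilon> > 0\<close> by (auto simp: \<delta>_def min_def)
  have "\<exists>y\<in>circle. \<forall>g\<in>carrier F2. dist (\<xi> g) (moebius_action g y) < \<epsilon>"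
    if "pseudotrajectory F2 F2_S circle moebius_action \<delta> \<xi>" for \<xi>
  proof -
    interpret moebius_pseudotrajectory \<delta> \<xi>
      using that \<delta> by unfold_locales
    show ?thesis
      using shadowed \<delta>(3) unfolding carrier_F2 by (meson le_less_trans mem_Collect_eq)
  qed
  then show "\<exists>\<delta>>0. \<forall>\<xi>. pseudotrajectory F2 F2_S circle moebius_action \<delta> \<xi> \<longrightarrow>
      (\<exists>y\<in>circle. \<forall>g\<in>carrier F2. dist (\<xi> g) (moebius_action g y) < \<epsilon>)"
    using \<delta>(1) by blast
qed

theorem mainTheorem2:
  "\<exists>\<Phi> :: (gen \<times> bool) list \<Rightarrow> complex \<Rightarrow> complex.
     dynamical_system F2 circle \<Phi> \<and>
     (\<exists>M. minimal_set F2 circle \<Phi> M \<and> cantor_set M) \<and>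
     shadowing_property F2 F2_S circle \<Phi>"
  using dynamical_system_moebius_action minimal_limit_set cantor_limit_set shadowing_moebius_action
  by blast

end
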